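(* For nonnegative integers $m,n$, let $S_{m,n}\subset\mathbb{C}$ be a configuration of $m+2$ points on the segment $[-1,1]$ including both endpoints $\pm1$, together with $n$ points on the open upper unit semicircle $\{e^{i\theta}:0<\theta<\pi\}$, and let $s_{m,n}=|\textsc{NC}(S_{m,n})|$. Then \[\sum_{m,n\ge0}s_{m,n}x^my^n=\left(\frac{C(y)-1-y}{y^2}\right)\left(\frac{1}{1-x(1+C(y))}\right),\] where $C(y)=\frac{1-\sqrt{1-4y}}{2y}=\sum_{n\ge0}\frac{1}{n+1}\binom{2n}{n}y^n$ is the generating function of the Catalan numbers.
   Context: For a finite set $P\subset\mathbb{C}$, a partition of $P$ is noncrossing if the convex hulls of its blocks are pairwise disjoint; $\textsc{NC}(P)$ denotes the set of noncrossing partitions of $P$. *)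

theory Defs
  imports "HOL-Analysis.Analysis" "HOL-Computational_Algebra.Formal_Power_Series"
begin

definition noncrossing_partitions :: "complex set \<Rightarrow> complex set set set" where
  "noncrossing_partitions P =
     {p. partition_on P p \<and> pairwise (\<lambda>A B. disjnt (convex hull A) (convex hull B)) p}"

definition is_configuration :: "nat \<Rightarrow> nat \<Rightarrow> complex set \<Rightarrow> bool" where
  "is_configuration m n S \<longleftrightarrow>
     (\<exists>A B. S = A \<union> B
        \<and> finite A \<and> card A = m + 2 \<and> A \<subseteq> closed_segment (-1) 1 \<and> -1 \<in> A \<and> 1 \<in> A
        \<and> finite B \<and> card B = n \<and> B \<subseteq> {exp (\<i> * of_real \<theta>) | \<theta>. 0 < \<theta> \<and> \<theta> < pi})"

text \<open>Power series in \<open>x\<close> and \<open>y\<close> are elements of \<^typ>\<open>real fps fps\<close>: the outer variable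
  is \<open>x\<close> and the coefficients are power series in \<open>y\<close>, embedded by \<^const>\<open>fps_const\<close>.
  The series below is \<open>C(y)\<close>; its closed form is \<open>catalan_gf_closed_form\<close>.\<close>

definition catalan_gf :: "real fps" where
  "catalan_gf = Abs_fps (\<lambda>n. 1 / (real n + 1) * real ((2 * n) choose n))"

lemma catalan_gf_rec:
  "(real n + 2) * fps_nth catalan_gf (Suc n) = (4 * real n + 2) * fps_nth catalan_gf n"
proof -
  have f: "real ((2 * k) choose k) = fact (2 * k) / (fact k * fact k)" for k
    using binomial_fact[of k "2 * k", where 'a = real] by simp
  have "fact (2 * Suc n) = (2 * real n + 2) * (2 * real n + 1) * (fact (2 * n) :: real)"
    by (simp add: algebra_simps)
  moreover have "fact (Suc n) = (real n + 1) * (fact n :: real)"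
    by simp
  moreover have "(fact n :: real) \<noteq> 0" "real n + 1 \<noteq> 0" "real n + 2 \<noteq> 0"
    by (auto simp: add_eq_0_iff)
  moreover have "real (Suc n) + 1 = real n + 2"
    by simp
  ultimately show ?thesis
    unfolding catalan_gf_def fps_nth_Abs_fps f by (simp only:) (simp add: divide_simps, simp add: algebra_simps)
qed

lemma half_gchoose_catalan:
  "((1/2 :: real) gchoose Suc n) * (-4) ^ Suc n = - 2 * fps_nth catalan_gf n"
proof (induction n)
  case 0
  show ?case by (simp add: catalan_gf_def)
next
  case (Suc n)
  have nz: "real n + 2 \<noteq> 0" by linarith
  have "((1/2 :: real) gchoose Suc (Suc n)) * (real n + 2) = (1/2 - (real n + 1)) * (1/2 gchoose Suc n)"
    using gbinomial_mult_1[of "1/2 :: real" "Suc n"] by (simp add: algebra_simps)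
  then have "(real n + 2) * (((1/2 :: real) gchoose Suc (Suc n)) * (-4) ^ Suc (Suc n)) =
      (4 * real n + 2) * (((1/2 :: real) gchoose Suc n) * (-4) ^ Suc n)" (is "?l = ?r")
  proof -
    assume *: "(1/2 gchoose Suc (Suc n)) * (real n + 2) = (1/2 - (real n + 1)) * (1/2 gchoose Suc n)"
    have "?l = ((1/2 gchoose Suc (Suc n)) * (real n + 2)) * (-4) ^ Suc (Suc n)"
      by (simp add: mult_ac)
    also have "\<dots> = ?r"
      unfolding * by (simp add: field_simps)
    finally show ?thesis .
  qed
  also have "\<dots> = (real n + 2) * (- 2 * fps_nth catalan_gf (Suc n))"
    unfolding Suc.IH using catalan_gf_rec[of n] by simp
  finally show ?case using nz mult_left_cancel by blast
qed

lemma catalan_gf_closed_form: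
  "catalan_gf = (1 - fps_radical root 2 (1 - 4 * fps_X)) / (2 * fps_X)"
proof -
  define b where "b = fps_binomial (1/2 :: real) oo (fps_const (-4) * fps_X)"
  have b_eq: "b = 1 - 2 * fps_X * catalan_gf"
  proof (rule fps_ext)
    fix n show "fps_nth b n = fps_nth (1 - 2 * fps_X * catalan_gf) n"
      using half_gchoose_catalan[of "n - 1"]
      by (cases n) (simp_all add: b_def fps_nth_compose_linear mult.assoc numeral_fps_const)
  qed
  have "b ^ 2 = (fps_binomial (1/2 :: real) ^ 2) oo (fps_const (-4) * fps_X)"
    unfolding b_def by (simp add: fps_compose_power)
  also have "fps_binomial (1/2 :: real) ^ 2 = 1 + fps_X"
    by (simp add: fps_binomial_power fps_binomial_1)
  also have "(1 + fps_X) oo (fps_const (-4) * fps_X) = (1 - 4 * fps_X :: real fps)"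
    by (simp add: fps_compose_add_distrib numeral_fps_const fps_const_neg[symmetric] del: fps_const_neg)
  finally have "b ^ Suc 1 = 1 - 4 * fps_X" by (simp add: power2_eq_square)
  then have "b = fps_radical root 2 (1 - 4 * fps_X)"
    by (subst (asm) radical_unique[where r = root]) (simp_all add: b_eq numeral_2_eq_2)
  moreover have "1 - b = 2 * fps_X * catalan_gf"
    by (simp add: b_eq)
  ultimately have "1 - fps_radical root 2 (1 - 4 * fps_X) = 2 * fps_X * catalan_gf"
    by simp
  moreover have "(2 * fps_X :: real fps) \<noteq> 0"
    by simp
  ultimately show ?thesis by (simp del: fps_divide_X)
qed

end

theory Submission
  imports Defs
begin

text \<open>
  Order the configuration along its convex boundary: first the diameter from \<open>-1\<close> to \<open>1\<close>, then
  the arc counterclockwise. The hulls of two disjoint sets \<open>U\<close>, \<open>V\<close> of points are disjoint iff no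
  two chords cross (\<open>a < b < c < d\<close> with \<open>a, c\<close> in one set and \<open>b, d\<close> in the other) and no point
  of one lies on the diameter between two points of the other. So the partitions
  to count are equivalence relations satisfying two order-theoretic conditions. Such a relation is
  cut at the successor \<open>q\<close> of the least element \<open>p\<close> within its block: the elements between \<open>p\<close> and
  \<open>q\<close> are unrelated to all others, and \<open>p\<close> carries no further information. With at least three
  points on the diameter, \<open>q\<close> is the next diameter point, or an arc point, or does not exist; this
  gives \<open>s\<^bsub>m+1,n\<^esub> = s\<^bsub>m,n\<^esub> + (\<Sum>i\<le>n. s\<^bsub>m,i\<^esub> C\<^bsub>n-i\<^esub>)\<close>. Two diameter points impose no collinearity
  condition, hence \<open>s\<^bsub>0,n\<^esub> = C\<^bsub>n+2\<^esub>\<close>.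
\<close>

subsection \<open>Noncrossing equivalence relations\<close>

text \<open>The elements of \<open>A\<close> stand for the collinear points.\<close>

definition nc_rels :: "'a::linorder set \<Rightarrow> 'a set \<Rightarrow> 'a rel set" where
  "nc_rels A X = {r. equiv X r
     \<and> (\<forall>a b c d. a < b \<longrightarrow> b < c \<longrightarrow> c < d \<longrightarrow> (a, c) \<in> r \<longrightarrow> (b, d) \<in> r \<longrightarrow> (a, b) \<in> r)
     \<and> (\<forall>a\<in>A. \<forall>b\<in>A \<inter> X. \<forall>c\<in>A. a < b \<longrightarrow> b < c \<longrightarrow> (a, c) \<in> r \<longrightarrow> (a, b) \<in> r)}"

lemma nc_relsI:
  assumes "r \<subseteq> X \<times> X" "\<And>x. x \<in> X \<Longrightarrow> (x, x) \<in> r" "\<And>x y. (x, y) \<in> r \<Longrightarrow> (y, x) \<in> r"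
    "\<And>x y z. (x, y) \<in> r \<Longrightarrow> (y, z) \<in> r \<Longrightarrow> (x, z) \<in> r"
    "\<And>a b c d. a < b \<Longrightarrow> b < c \<Longrightarrow> c < d \<Longrightarrow> (a, c) \<in> r \<Longrightarrow> (b, d) \<in> r \<Longrightarrow> (a, b) \<in> r"
    "\<And>a b c. a \<in> A \<Longrightarrow> b \<in> A \<Longrightarrow> b \<in> X \<Longrightarrow> c \<in> A \<Longrightarrow> a < b \<Longrightarrow> b < c \<Longrightarrow> (a, c) \<in> r \<Longrightarrow> (a, b) \<in> r"
  shows "r \<in> nc_rels A X"
  unfolding nc_rels_def mem_Collect_eq
proof (intro conjI equivI refl_onI symI transI ballI allI impI)
  fix a b c assume "a \<in> A" "b \<in> A \<inter> X" "c \<in> A" "a < b" "b < c" "(a, c) \<in> r"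
  then show "(a, b) \<in> r" using assms(6) by blast
qed (fact assms)+

lemma nc_relsD:
  assumes "r \<in> nc_rels A X"
  shows "r \<subseteq> X \<times> X" "\<And>x. x \<in> X \<Longrightarrow> (x, x) \<in> r" "\<And>x y. (x, y) \<in> r \<Longrightarrow> (y, x) \<in> r"
    "\<And>x y z. (x, y) \<in> r \<Longrightarrow> (y, z) \<in> r \<Longrightarrow> (x, z) \<in> r"
    "\<And>a b c d. a < b \<Longrightarrow> b < c \<Longrightarrow> c < d \<Longrightarrow> (a, c) \<in> r \<Longrightarrow> (b, d) \<in> r \<Longrightarrow> (a, b) \<in> r"
    "\<And>a b c. a \<in> A \<Longrightarrow> b \<in> A \<Longrightarrow> b \<in> X \<Longrightarrow> c \<in> A \<Longrightarrow> a < b \<Longrightarrow> b < c \<Longrightarrow> (a, c) \<in> r \<Longrightarrow> (a, b) \<in> r"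
proof -
  from assms have r: "equiv X r"
    and nc: "\<forall>a b c d. a < b \<longrightarrow> b < c \<longrightarrow> c < d \<longrightarrow> (a, c) \<in> r \<longrightarrow> (b, d) \<in> r \<longrightarrow> (a, b) \<in> r"
    and cv: "\<forall>a\<in>A. \<forall>b\<in>A \<inter> X. \<forall>c\<in>A. a < b \<longrightarrow> b < c \<longrightarrow> (a, c) \<in> r \<longrightarrow> (a, b) \<in> r"
    unfolding nc_rels_def by blast+
  from r show "r \<subseteq> X \<times> X" by (elim equivE)
  from r show "\<And>x. x \<in> X \<Longrightarrow> (x, x) \<in> r" by (elim equivE) (rule refl_onD)
  from r show "\<And>x y. (x, y) \<in> r \<Longrightarrow> (y, x) \<in> r" by (elim equivE) (rule symD)
  from r show "\<And>x y z. (x, y) \<in> r \<Longrightarrow> (y, z) \<in> r \<Longrightarrow> (x, z) \<in> r" by (elim equivE) (rule transD)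
  show "(a, b) \<in> r" if "a < b" "b < c" "c < d" "(a, c) \<in> r" "(b, d) \<in> r" for a b c d
    using nc that by blast
  show "(a, b) \<in> r" if "a \<in> A" "b \<in> A" "b \<in> X" "c \<in> A" "a < b" "b < c" "(a, c) \<in> r" for a b c
    using cv that by blast
qed

lemma finite_nc_rels: "finite X \<Longrightarrow> finite (nc_rels A X)"
  by (rule finite_subset[of _ "Pow (X \<times> X)"]) (auto dest: nc_relsD(1))

lemma nc_rels_change:
  assumes "r \<in> nc_rels A X"
    and "\<And>a b c. a \<in> B \<Longrightarrow> b \<in> B \<Longrightarrow> b \<in> X \<Longrightarrow> c \<in> B \<Longrightarrow> a < b \<Longrightarrow> b < c \<Longrightarrow> (a, c) \<in> r \<Longrightarrow> (a, b) \<in> r"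
  shows "r \<in> nc_rels B X"
  using assms(1) assms(2) by (simp add: nc_rels_def)

text \<open>Relations live on \<open>X\<close>, so chord endpoints in \<open>A\<close> lie in
  \<open>X\<close> anyway. This allows replacing \<open>A\<close> by any set with the same trace on
  \<open>X\<close>.\<close>

lemma nc_rels_Int: "nc_rels (A \<inter> X) X = nc_rels A X"
proof (intro equalityI subsetI)
  fix r assume r: "r \<in> nc_rels (A \<inter> X) X"
  show "r \<in> nc_rels A X"
  proof (rule nc_rels_change[OF r])
    fix a b c assume *: "a \<in> A" "b \<in> A" "b \<in> X" "c \<in> A" "a < b" "b < c" "(a, c) \<in> r"
    then have "a \<in> X" "c \<in> X" using nc_relsD(1)[OF r] by auto
    then show "(a, b) \<in> r" using * nc_relsD(6)[OF r, of a b c] by simp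
  qed
next
  fix r assume r: "r \<in> nc_rels A X"
  show "r \<in> nc_rels (A \<inter> X) X"
    by (rule nc_rels_change[OF r]) (meson IntD1 nc_relsD(6)[OF r])
qed

lemma nc_rels_restrict:
  assumes r: "r \<in> nc_rels A X" and "Y \<subseteq> X"
  shows "r \<inter> Y \<times> Y \<in> nc_rels A Y"
proof (rule nc_relsI)
  note * = nc_relsD[OF r]
  show "(x, x) \<in> r \<inter> Y \<times> Y" if "x \<in> Y" for x using that *(2) assms(2) by auto
  show "(y, x) \<in> r \<inter> Y \<times> Y" if "(x, y) \<in> r \<inter> Y \<times> Y" for x y using that *(3) by auto
  show "(x, z) \<in> r \<inter> Y \<times> Y" if "(x, y) \<in> r \<inter> Y \<times> Y" "(y, z) \<in> r \<inter> Y \<times> Y" for x y z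
    using that *(4)[of x y z] by simp
  show "(a, b) \<in> r \<inter> Y \<times> Y" if "a < b" "b < c" "c < d" "(a, c) \<in> r \<inter> Y \<times> Y"
    "(b, d) \<in> r \<inter> Y \<times> Y" for a b c d
    using that *(5)[of a b c d] by simp
  show "(a, b) \<in> r \<inter> Y \<times> Y" if "a \<in> A" "b \<in> A" "b \<in> Y" "c \<in> A" "a < b" "b < c"
    "(a, c) \<in> r \<inter> Y \<times> Y" for a b c
    using that *(6)[of a b c] assms(2) by auto
qed simp

text \<open>The collinearity condition needs three distinct points of \<open>A \<inter> X\<close>.
  This serves the case of two diameter points.\<close>

lemma nc_rels_card_le_2:
  assumes "finite X" "card (A \<inter> X) \<le> 2"
  shows "nc_rels A X = nc_rels {} X"
proof (intro equalityI subsetI)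
  fix r assume r: "r \<in> nc_rels A X"
  show "r \<in> nc_rels {} X"
    by (rule nc_rels_change[OF r]) simp
next
  fix r assume r: "r \<in> nc_rels {} X"
  show "r \<in> nc_rels A X"
  proof (rule nc_rels_change[OF r])
    fix a b c assume *: "a \<in> A" "b \<in> A" "b \<in> X" "c \<in> A" "a < b" "b < c" "(a, c) \<in> r"
    then have "{a, b, c} \<subseteq> A \<inter> X" using nc_relsD(1)[OF r] by auto
    from card_mono[OF _ this] assms have "card {a, b, c} \<le> 2" by auto
    moreover have "a \<noteq> b" "b \<noteq> c" "a \<noteq> c" using * by auto
    ultimately show "(a, b) \<in> r" by simp
  qed
qed

lemma nc_rels_empty: "nc_rels A {} = {{}}"
proof
  show "nc_rels A {} \<subseteq> {{}}" by (auto dest: nc_relsD(1))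
  show "{{}} \<subseteq> nc_rels A {}" by (auto intro: nc_relsI)
qed

section \<open>Cutting a relation at its least element\<close>

lemma bij_betw_nc_rels_isolated:
  assumes p: "\<And>y. y \<in> Y \<Longrightarrow> p < y"
  shows "bij_betw (\<lambda>r. r \<inter> Y \<times> Y)
    {r \<in> nc_rels A (insert p Y). \<forall>y\<in>Y. (p, y) \<notin> r} (nc_rels A Y)"
proof (rule bij_betw_byWitness[where f' = "insert (p, p)"])
  have pY: "p \<notin> Y" using p by blast
  show "\<forall>r\<in>{r \<in> nc_rels A (insert p Y). \<forall>y\<in>Y. (p, y) \<notin> r}. insert (p, p) (r \<inter> Y \<times> Y) = r"
  proof
    fix r assume "r \<in> {r \<in> nc_rels A (insert p Y). \<forall>y\<in>Y. (p, y) \<notin> r}"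
    then have r: "r \<in> nc_rels A (insert p Y)" and no: "\<forall>y\<in>Y. (p, y) \<notin> r" by auto
    then have "\<forall>y\<in>Y. (y, p) \<notin> r" using nc_relsD(3)[OF r] by metis
    with no nc_relsD(1,2)[OF r] show "insert (p, p) (r \<inter> Y \<times> Y) = r" by auto
  qed
  show "\<forall>r\<in>nc_rels A Y. insert (p, p) r \<inter> Y \<times> Y = r"
    using pY by (auto dest: nc_relsD(1))
  show "(\<lambda>r. r \<inter> Y \<times> Y) ` {r \<in> nc_rels A (insert p Y). \<forall>y\<in>Y. (p, y) \<notin> r} \<subseteq> nc_rels A Y"
    by (auto intro!: nc_rels_restrict)
  show "insert (p, p) ` nc_rels A Y \<subseteq> {r \<in> nc_rels A (insert p Y). \<forall>y\<in>Y. (p, y) \<notin> r}"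
  proof clarify
    fix r assume r: "r \<in> nc_rels A Y"
    note * = nc_relsD[OF r]
    \<comment> \<open>A singleton block contributes no chord, and \<open>p\<close>, being least,
      never lies between two points.\<close>
    have "insert (p, p) r \<in> nc_rels A (insert p Y)"
    proof (rule nc_relsI)
      fix a b c d assume "a < b" "b < c" "c < d" "(a, c) \<in> insert (p, p) r" "(b, d) \<in> insert (p, p) r"
      then have "(a, c) \<in> r" "(b, d) \<in> r" by auto
      then show "(a, b) \<in> insert (p, p) r" using *(5)[of a b c d] \<open>a < b\<close> \<open>b < c\<close> \<open>c < d\<close> by simp
    next
      fix a b c assume "a \<in> A" "b \<in> A" "b \<in> insert p Y" "c \<in> A" "a < b" "b < c"
        "(a, c) \<in> insert (p, p) r"
      moreover from this have "(a, c) \<in> r" by auto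
      moreover from this have "a \<in> Y" using *(1) by blast
      ultimately show "(a, b) \<in> insert (p, p) r"
        using *(6)[of a b c] p[of a] by auto
    next
      show "insert (p, p) r \<subseteq> insert p Y \<times> insert p Y" using *(1) by auto
      show "(x, x) \<in> insert (p, p) r" if "x \<in> insert p Y" for x using that *(2) by auto
      show "(y, x) \<in> insert (p, p) r" if "(x, y) \<in> insert (p, p) r" for x y using that *(3) by auto
      show "(x, z) \<in> insert (p, p) r" if "(x, y) \<in> insert (p, p) r" "(y, z) \<in> insert (p, p) r" for x y z
        using that *(4)[of x y z] by auto
    qed
    moreover have "\<forall>y\<in>Y. (p, y) \<notin> insert (p, p) r" using *(1) pY by auto
    ultimately show "insert (p, p) r \<in> nc_rels A (insert p Y) \<and> (\<forall>y\<in>Y. (p, y) \<notin> insert (p, p) r)"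
      by blast
  qed
qed

text \<open>Here \<open>q\<close> is the successor of the least element \<open>p\<close> in its block. Noncrossing forces
  the elements between \<open>p\<close> and \<open>q\<close> to be unrelated to the rest, and \<open>p\<close> can be
  reinserted into the block of \<open>q\<close>.\<close>

lemma bij_betw_nc_rels_successor:
  assumes p: "\<And>y. y \<in> Y \<Longrightarrow> p < y" and q: "q \<in> Y"
    and init: "\<And>y z. y \<in> Y \<Longrightarrow> z \<in> A \<Longrightarrow> y < z \<Longrightarrow> y \<in> A"
    and ok: "\<And>y. y \<in> Y \<Longrightarrow> y < q \<Longrightarrow> p \<in> A \<Longrightarrow> y \<in> A \<Longrightarrow> q \<notin> A"
  defines "L \<equiv> {y \<in> Y. y < q}" and "U \<equiv> {y \<in> Y. q \<le> y}"
  shows "bij_betw (\<lambda>r. (r \<inter> L \<times> L, r \<inter> U \<times> U))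
    {r \<in> nc_rels A (insert p Y). (p, q) \<in> r \<and> (\<forall>y\<in>Y. y < q \<longrightarrow> (p, y) \<notin> r)}
    (nc_rels A L \<times> nc_rels A U)" (is "bij_betw ?f ?J ?T")
proof -
  \<comment> \<open>\<open>h\<close> moves \<open>p\<close> onto \<open>q\<close>; pulling
    \<open>r2\<close> back along it puts \<open>p\<close> into the block of \<open>q\<close>, which
    undoes the cut.\<close>
  define h where "h x = (if x = p then q else x)" for x
  define g where "g = (\<lambda>(r1, r2). r1 \<union> {(x, y). (h x, h y) \<in> r2})"
  have pY: "p \<notin> Y" using p by blast
  have LU: "L \<union> U = Y" "L \<inter> U = {}" "q \<in> U" "L \<subseteq> insert p Y" "U \<subseteq> insert p Y"
    using q by (auto simp: L_def U_def)
  show ?thesis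
  proof (rule bij_betw_byWitness[where f' = g])
    show "\<forall>r\<in>?J. g (?f r) = r"
    proof
      fix r assume "r \<in> ?J"
      then have r: "r \<in> nc_rels A (insert p Y)" and pq: "(p, q) \<in> r"
        and no: "\<And>y. y \<in> L \<Longrightarrow> (p, y) \<notin> r" by (auto simp: L_def)
      note * = nc_relsD[OF r]
      \<comment> \<open>Relating \<open>y\<close> to \<open>q\<close> would bring \<open>y\<close>
        into the block of \<open>p\<close>, against the choice of \<open>q\<close>; relating it to a
        later point would give a chord crossing the one from \<open>p\<close> to
        \<open>q\<close>.\<close>
      have sep: "(y, z) \<notin> r" if "y \<in> L" "z \<in> U" for y z
      proof
        assume yz: "(y, z) \<in> r"
        show False
        proof (cases "z = q")
          case True
          then show False using no[OF that(1)] yz pq *(3)[of y q] *(4)[of p q y] by simp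
        next
          case False
          then have "p < y" "y < q" "q < z" using that p by (auto simp: L_def U_def)
          then show False using *(5)[of p y q z] pq yz no that(1) by simp
        qed
      qed
      have hx: "(x, h x) \<in> r" if "x \<in> insert p Y" for x
        using that pq *(2) by (auto simp: h_def)
      have hr: "(h x, h y) \<in> r \<longleftrightarrow> (x, y) \<in> r" if "x \<in> insert p Y" "y \<in> insert p Y" for x y
        using hx[OF that(1)] hx[OF that(2)] *(3)[of x "h x"] *(3)[of y "h y"] *(4)[of "h x" x y]
          *(4)[of "h x" y "h y"] *(4)[of x "h x" "h y"] *(4)[of x "h y" y] by blast
      have hU: "h x \<in> U \<longleftrightarrow> x = p \<or> x \<in> U" for x using LU(3) by (auto simp: h_def)
      show "g (?f r) = r"
      proof (rule set_eqI, clarify)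
        fix x y
        have "(x, y) \<in> g (?f r) \<longleftrightarrow> (x, y) \<in> r \<and> (x \<in> L \<and> y \<in> L \<or> h x \<in> U \<and> h y \<in> U)"
          using hr[of x y] LU(1) hU[of x] hU[of y] by (auto simp: g_def)
        also have "\<dots> \<longleftrightarrow> (x, y) \<in> r"
          unfolding hU using *(1) *(3)[of x y] *(3)[of y x] sep[of x y] sep[of y x] no[of x] no[of y] LU(1)
          by auto
        finally show "(x, y) \<in> g (?f r) \<longleftrightarrow> (x, y) \<in> r" .
      qed
    qed
    show "\<forall>s\<in>?T. ?f (g s) = s"
    proof
      fix t assume "t \<in> ?T"
      then obtain r1 r2 where t: "t = (r1, r2)" and r1: "r1 \<in> nc_rels A L" and r2: "r2 \<in> nc_rels A U"
        by auto
      have h: "h x = x" if "x \<in> Y" for x using that pY by (auto simp: h_def)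
      have s: "r1 \<subseteq> L \<times> L" "r2 \<subseteq> U \<times> U"
        using nc_relsD(1)[OF r1] nc_relsD(1)[OF r2] by auto
      have "(x, y) \<in> g (r1, r2) \<inter> L \<times> L \<longleftrightarrow> (x, y) \<in> r1" for x y
        using s h[of x] h[of y] LU by (auto simp: g_def)
      moreover have "(x, y) \<in> g (r1, r2) \<inter> U \<times> U \<longleftrightarrow> (x, y) \<in> r2" for x y
        using s h[of x] h[of y] LU by (auto simp: g_def)
      ultimately show "?f (g t) = t"
        unfolding t by (simp only: prod.inject set_eq_iff split_paired_All) blast
    qed
    show "?f ` ?J \<subseteq> ?T"
      using nc_rels_restrict LU(4,5) by blast
    show "g ` ?T \<subseteq> ?J"
    proof clarify
      fix r1 r2 assume r1: "r1 \<in> nc_rels A L" and r2: "r2 \<in> nc_rels A U"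
      note * = nc_relsD[OF r1] and ** = nc_relsD[OF r2]
      have mem: "(x, y) \<in> g (r1, r2) \<longleftrightarrow> (x, y) \<in> r1 \<or> (h x, h y) \<in> r2" for x y
        by (simp add: g_def)
      have hU: "h x \<in> U \<longleftrightarrow> x = p \<or> x \<in> U" for x using LU(3) by (auto simp: h_def)
      have r2U: "(x = p \<or> x \<in> U) \<and> (y = p \<or> y \<in> U)" if "(h x, h y) \<in> r2" for x y
        using that **(1) hU by blast
      have hp: "h p = q" "\<And>x. x \<noteq> p \<Longrightarrow> h x = x" by (auto simp: h_def)
      have Lq: "x \<in> Y \<and> x < q \<and> p < x" if "x \<in> L" for x using that p by (auto simp: L_def)
      have Uq: "x \<in> Y \<and> q \<le> x \<and> p < x" if "x \<in> U" for x using that p by (auto simp: U_def)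
      have "g (r1, r2) \<in> nc_rels A (insert p Y)"
      proof (rule nc_relsI)
        show "g (r1, r2) \<subseteq> insert p Y \<times> insert p Y"
          using *(1) r2U LU(1) unfolding g_def by blast
        show "(x, x) \<in> g (r1, r2)" if "x \<in> insert p Y" for x
          using that *(2) **(2) LU(1) hU unfolding mem by blast
        show "(y, x) \<in> g (r1, r2)" if "(x, y) \<in> g (r1, r2)" for x y
          using that *(3)[of x y] **(3)[of "h x" "h y"] unfolding mem by auto
        show "(x, z) \<in> g (r1, r2)" if "(x, y) \<in> g (r1, r2)" "(y, z) \<in> g (r1, r2)" for x y z
        proof -
          have no: False if "(u, v) \<in> r1 \<or> (v, u) \<in> r1" "(h v, h w) \<in> r2 \<or> (h w, h v) \<in> r2" for u v w
            using that *(1) r2U[of v w] r2U[of w v] Lq[of v] LU(2) by auto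
          show ?thesis
            using that *(4)[of x y z] **(4)[of "h x" "h y" "h z"] no[of x y z] no[of z y x]
            unfolding mem by blast
        qed
        show "(a, b) \<in> g (r1, r2)" if lt: "a < b" "b < c" "c < d"
          and ac: "(a, c) \<in> g (r1, r2)" and bd: "(b, d) \<in> g (r1, r2)" for a b c d
        proof (cases "(a, c) \<in> r1")
          case True
          then have "p < b" "b < q" using *(1) Lq lt by force+
          then have "(b, d) \<in> r1" using bd r2U[of b d] Uq unfolding mem by force
          then show ?thesis using True lt *(5)[of a b c d] unfolding mem by blast
        next
          case False
          then have ac: "(h a, h c) \<in> r2" using ac unfolding mem by blast
          then have "p < c" "q \<le> c"
            using r2U[of a c] Uq[of c] Uq[of a] lt by force+
          then have "(b, d) \<notin> r1" using *(1) Lq[of d] lt by force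
          then have bd: "(h b, h d) \<in> r2" using bd unfolding mem by blast
          have "p \<le> a" using r2U[OF ac] Uq[of a] by force
          then have ne: "b \<noteq> p" "c \<noteq> p" "d \<noteq> p" using lt by auto
          have bU: "b \<in> U" using r2U[OF bd] ne by blast
          \<comment> \<open>If \<open>a = p\<close>, the moved chord starts at \<open>q\<close>,
            which may coincide with \<open>b\<close>; otherwise the moved points still form a
            crossing pattern in \<open>U\<close>.\<close>
          have "(h a, b) \<in> r2"
          proof (cases "h a = b")
            case True
            then show ?thesis using **(2) bU by blast
          next
            case False
            then have "h a < b" using Uq[OF bU] lt by (auto simp: h_def)
            then show ?thesis using **(5)[of "h a" b c d] ac bd lt ne hp by auto
          qed
          then show ?thesis using ne hp unfolding mem by simp
        qed
        show "(a, b) \<in> g (r1, r2)" if A: "a \<in> A" "b \<in> A" "b \<in> insert p Y" "c \<in> A"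
          and lt: "a < b" "b < c" and ac: "(a, c) \<in> g (r1, r2)" for a b c
        proof (cases "(a, c) \<in> r1")
          case True
          then have "p < a" "c < q" using *(1) Lq by blast+
          then have "b \<in> L" using A lt by (auto simp: L_def)
          then show ?thesis using True A lt *(6)[of a b c] unfolding mem by blast
        next
          case False
          then have ac: "(h a, h c) \<in> r2" using ac unfolding mem by blast
          have "p \<le> a" using r2U[OF ac] Uq[of a] by force
          then have ne: "b \<noteq> p" "c \<noteq> p" using lt by auto
          then have bY: "b \<in> Y" and cU: "c \<in> U" using A r2U[OF ac] by auto
          have qA: "q \<in> A" using init[OF q A(4)] Uq[OF cU] A(4) by (cases "c = q") auto
          have haA: "h a \<in> A" using A qA by (auto simp: h_def)
          \<comment> \<open>For \<open>a = p\<close> both \<open>p\<close> and \<open>q\<close> are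
            in \<open>A\<close>, and \<open>ok\<close> then excludes a point \<open>b\<close> of
            \<open>A\<close> before \<open>q\<close>.\<close>
          have bU: "b \<in> U"
          proof (cases "a = p")
            case True
            then show ?thesis using ok[OF bY] A qA bY by (force simp: U_def)
          next
            case False
            then have "q \<le> a" using r2U[OF ac] Uq[of a] by blast
            then show ?thesis using lt bY by (simp add: U_def)
          qed
          have "(h a, b) \<in> r2"
          proof (cases "h a = b")
            case True
            then show ?thesis using **(2) bU by blast
          next
            case False
            then have "h a < b" using Uq[OF bU] lt by (auto simp: h_def)
            then show ?thesis using **(6)[of "h a" b c] ac lt ne hp haA A bU by auto
          qed
          then show ?thesis using ne hp unfolding mem by simp
        qed
      qed
      moreover have "(p, q) \<in> g (r1, r2)"
        using **(2) LU(3) by (auto simp: mem h_def)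
      moreover have "(p, y) \<notin> g (r1, r2)" if "y \<in> Y" "y < q" for y
        using *(1) r2U[of p y] that Uq[of y] pY Lq[of p] p[of y] unfolding mem by force
      ultimately show "g (r1, r2) \<in> nc_rels A (insert p Y) \<and> (p, q) \<in> g (r1, r2)
          \<and> (\<forall>y\<in>Y. y < q \<longrightarrow> (p, y) \<notin> g (r1, r2))"
        by blast
    qed
  qed
qed

text \<open>The first summand counts the relations in which \<open>p\<close> is alone. If
  \<open>p\<close> and \<open>q\<close> are in \<open>A\<close> with a point between them, that
  point is in \<open>A\<close> by \<open>init\<close> and would be related to \<open>p\<close> as
  well, so \<open>q\<close> cannot be the successor and contributes zero.\<close>

lemma card_nc_rels_insert_least:
  fixes Y :: "'a::linorder set"
  assumes fin: "finite Y" and p: "\<And>y. y \<in> Y \<Longrightarrow> p < y"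
    and init: "\<And>y z. y \<in> Y \<Longrightarrow> z \<in> A \<Longrightarrow> y < z \<Longrightarrow> y \<in> A"
  shows "card (nc_rels A (insert p Y)) = card (nc_rels A Y) +
    (\<Sum>q\<in>Y. if p \<in> A \<and> q \<in> A \<and> (\<exists>y\<in>Y. y < q) then 0
       else card (nc_rels A {y\<in>Y. y < q}) * card (nc_rels A {y\<in>Y. q \<le> y}))"
proof -
  let ?R = "nc_rels A (insert p Y)"
  define J where "J q = {r \<in> ?R. (p, q) \<in> r \<and> (\<forall>y\<in>Y. y < q \<longrightarrow> (p, y) \<notin> r)}" for q
  define I where "I = {r \<in> ?R. \<forall>y\<in>Y. (p, y) \<notin> r}"
  have finR: "finite ?R" using fin by (simp add: finite_nc_rels)
  \<comment> \<open>A relation in which \<open>p\<close> is not alone falls into \<open>J q\<close>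
    for the least \<open>q\<close> in \<open>Y\<close> related to \<open>p\<close>.\<close>
  have "?R = I \<union> (\<Union>q\<in>Y. J q)"
  proof (intro equalityI subsetI)
    fix r assume r: "r \<in> ?R"
    show "r \<in> I \<union> (\<Union>q\<in>Y. J q)"
    proof (cases "{y\<in>Y. (p, y) \<in> r} = {}")
      case True
      then show ?thesis using r by (auto simp: I_def)
    next
      case False
      let ?q = "Min {y\<in>Y. (p, y) \<in> r}"
      have "?q \<in> {y\<in>Y. (p, y) \<in> r}" using False fin by (intro Min_in) auto
      moreover have "(p, y) \<notin> r" if "y \<in> Y" "y < ?q" for y
        using that fin Min_le[of "{y\<in>Y. (p, y) \<in> r}" y] by (auto simp flip: not_less)
      ultimately show ?thesis using r by (auto simp: J_def)
    qed
  qed (auto simp: I_def J_def)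
  moreover have "I \<inter> (\<Union>q\<in>Y. J q) = {}" by (auto simp: I_def J_def)
  moreover have "finite I" "finite (\<Union>q\<in>Y. J q)"
    by (rule finite_subset[OF _ finR], force simp: I_def J_def)+
  ultimately have "card ?R = card I + card (\<Union>q\<in>Y. J q)"
    by (metis card_Un_disjoint)
  moreover have "card (\<Union>q\<in>Y. J q) = (\<Sum>q\<in>Y. card (J q))"
  proof (rule card_UN_disjoint)
    show "\<forall>q\<in>Y. finite (J q)"
      by (auto intro: finite_subset[OF _ finR] simp: J_def)
    show "\<forall>q\<in>Y. \<forall>q'\<in>Y. q \<noteq> q' \<longrightarrow> J q \<inter> J q' = {}"
      by (auto simp: J_def)
  qed (fact fin)
  moreover have "card I = card (nc_rels A Y)"
    unfolding I_def by (rule bij_betw_same_card[OF bij_betw_nc_rels_isolated]) (fact p)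
  moreover have "card (J q) = (if p \<in> A \<and> q \<in> A \<and> (\<exists>y\<in>Y. y < q) then 0
       else card (nc_rels A {y\<in>Y. y < q}) * card (nc_rels A {y\<in>Y. q \<le> y}))" if q: "q \<in> Y" for q
  proof (cases "p \<in> A \<and> q \<in> A \<and> (\<exists>y\<in>Y. y < q)")
    case True
    then obtain y where y: "y \<in> Y" "y < q" "p \<in> A" "q \<in> A" by blast
    then have "y \<in> A" using init by blast
    then have "J q = {}" using y nc_relsD(6)[of _ A "insert p Y" p y q] p by (auto simp: J_def)
    then show ?thesis using True by simp
  next
    case False
    have "bij_betw (\<lambda>r. (r \<inter> {y\<in>Y. y < q} \<times> {y\<in>Y. y < q}, r \<inter> {y\<in>Y. q \<le> y} \<times> {y\<in>Y. q \<le> y}))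
      (J q) (nc_rels A {y\<in>Y. y < q} \<times> nc_rels A {y\<in>Y. q \<le> y})"
      unfolding J_def using False by (intro bij_betw_nc_rels_successor p q) (auto intro: init)
    from bij_betw_same_card[OF this] show ?thesis using False by (auto simp: card_cartesian_product)
  qed
  ultimately show ?thesis by simp
qed

text \<open>Sending \<open>q\<close> to the number of smaller elements enumerates
  \<open>{..<card Y}\<close>. This turns sums over cut positions into convolutions.\<close>

lemma sum_card_less:
  fixes Y :: "'a::linorder set" and f :: "nat \<Rightarrow> 'b::comm_monoid_add"
  assumes "finite Y"
  shows "(\<Sum>q\<in>Y. f (card {y\<in>Y. y < q})) = (\<Sum>i<card Y. f i)"
  using assms
proof (induction Y rule: finite_linorder_max_induct)
  case (insert b Y)
  have b: "{y \<in> insert b Y. y < b} = Y" "b \<notin> Y" using insert by auto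
  have "{y \<in> insert b Y. y < q} = {y\<in>Y. y < q}" if "q \<in> Y" for q
    using insert that by (auto dest: less_asym)
  then have "(\<Sum>q\<in>Y. f (card {y \<in> insert b Y. y < q})) = (\<Sum>q\<in>Y. f (card {y\<in>Y. y < q}))"
    by (intro sum.cong) auto
  then show ?case using insert b by (simp add: add.commute)
qed simp

section \<open>The Catalan recurrence and the count without collinearity\<close>

lemma catalan_gf_quadratic: "catalan_gf = 1 + fps_X * catalan_gf ^ 2"
proof -
  define R where "R = fps_radical root 2 (1 - 4 * fps_X :: real fps)"
  have R2: "R ^ 2 = 1 - 4 * fps_X"
    using power_radical[of "1 - 4 * fps_X :: real fps" root 1]
    by (simp add: R_def numeral_2_eq_2)
  have R0: "fps_nth R 0 = 1" by (simp add: R_def numeral_2_eq_2)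
  \<comment> \<open>\<open>D\<close> is \<open>(1 - R) / (2 * fps_X)\<close>, a power series because
    \<open>R\<close> has constant term 1.\<close>
  define D where "D = fps_const (1/2) * fps_shift 1 (1 - R)"
  have D: "1 - R = (2 * fps_X) * D"
    by (rule fps_ext) (use R0 in \<open>auto simp: D_def fps_X_mult_nth mult.assoc numeral_fps_const\<close>)
  have nz: "(2 * fps_X :: real fps) \<noteq> 0" by simp
  have "catalan_gf = D"
    unfolding catalan_gf_closed_form R_def[symmetric] D using nz by (simp del: fps_divide_X)
  then have R: "R = 1 - 2 * fps_X * catalan_gf" using D by (simp add: algebra_simps)
  \<comment> \<open>This is the square of \<open>R = 1 - 2 * fps_X * catalan_gf\<close> compared
    with \<open>R2\<close>; the factor \<open>4 * fps_X\<close> then cancels in an integral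
    domain.\<close>
  have "(4 * fps_X) * (fps_X * catalan_gf ^ 2 - catalan_gf + 1) = 0"
    using R2 unfolding R by (simp add: power2_eq_square algebra_simps)
  then have "fps_X * catalan_gf ^ 2 - catalan_gf + 1 = 0"
    by (subst (asm) mult_eq_0_iff) simp
  then show ?thesis by (simp add: algebra_simps)
qed


lemma catalan_gf_0: "fps_nth catalan_gf 0 = 1"
  by (simp add: catalan_gf_def)

lemma catalan_gf_Suc:
  "fps_nth catalan_gf (Suc n) = (\<Sum>i\<le>n. fps_nth catalan_gf i * fps_nth catalan_gf (n - i))"
proof -
  have "fps_nth catalan_gf (Suc n) = fps_nth (1 + fps_X * (catalan_gf * catalan_gf)) (Suc n)"
    using catalan_gf_quadratic by (simp add: power2_eq_square)
  also have "\<dots> = fps_nth (catalan_gf * catalan_gf) n" by (simp del: fps_mult_nth)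
  finally show ?thesis by (simp add: fps_mult_nth atMost_atLeast0)
qed

lemma card_ge_eq_diff:
  fixes Y :: "'a::linorder set"
  assumes "finite Y"
  shows "card {y\<in>Y. q \<le> y} = card Y - card {y\<in>Y. y < q}"
proof -
  have "{y\<in>Y. q \<le> y} = Y - {y\<in>Y. y < q}" by auto
  then show ?thesis using assms by (simp add: card_Diff_subset)
qed

text \<open>With \<open>A\<close> empty no summand is suppressed, and cutting at the successor
  reproduces the convolution recurrence \<open>catalan_gf_Suc\<close>.\<close>

lemma card_nc_rels_empty:
  fixes X :: "'a::linorder set"
  assumes "finite X"
  shows "real (card (nc_rels {} X)) = fps_nth catalan_gf (card X)"
  using assms
proof (induction "card X" arbitrary: X rule: less_induct)
  case less
  show ?case
  proof (cases "X = {}")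
    case True
    then show ?thesis by (simp add: nc_rels_empty catalan_gf_0)
  next
    case False
    define p where "p = Min X"
    define Y where "Y = X - {p}"
    have X: "X = insert p Y" and pY: "p \<notin> Y" and finY: "finite Y"
      using False less.prems Min_in[of X] by (auto simp: Y_def p_def simp del: Min_in)
    have p: "p < y" if "y \<in> Y" for y
      using that less.prems by (auto simp: Y_def p_def order_less_le)
    have cX: "card X = Suc (card Y)" using X pY finY by simp
    have IH: "real (card (nc_rels {} Z)) = fps_nth catalan_gf (card Z)" if "Z \<subseteq> Y" for Z
    proof (rule less.hyps)
      show "card Z < card X" using card_mono[OF finY that] cX by linarith
      show "finite Z" using that finY finite_subset by blast
    qed
    have "real (card (nc_rels {} X)) = fps_nth catalan_gf (card Y) +
      (\<Sum>q\<in>Y. fps_nth catalan_gf (card {y\<in>Y. y < q}) * fps_nth catalan_gf (card Y - card {y\<in>Y. y < q}))"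
      unfolding X using p finY
      by (subst card_nc_rels_insert_least) (simp_all add: IH card_ge_eq_diff)
    also have "(\<Sum>q\<in>Y. fps_nth catalan_gf (card {y\<in>Y. y < q}) * fps_nth catalan_gf (card Y - card {y\<in>Y. y < q}))
      = (\<Sum>i<card Y. fps_nth catalan_gf i * fps_nth catalan_gf (card Y - i))"
      by (rule sum_card_less) (fact finY)
    \<comment> \<open>The relations with \<open>p\<close> alone supply the missing term
      \<open>i = card Y\<close>, since the zeroth Catalan number is 1.\<close>
    finally show ?thesis
      by (simp add: cX catalan_gf_Suc catalan_gf_0 lessThan_Suc_atMost[symmetric])
  qed
qed

text \<open>The factor \<open>fps_shift 2 catalan_gf\<close> is \<open>(C(y) - 1 - y) / y^2\<close>
  and accounts for two diameter points; removing the least diameter point strips one factor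
  \<open>1 + C(y)\<close>.\<close>

lemma card_nc_rels:
  fixes A B :: "'a::linorder set"
  assumes "finite A" "finite B" "\<And>a b. a \<in> A \<Longrightarrow> b \<in> B \<Longrightarrow> a < b" "card A = m + 2"
  shows "real (card (nc_rels A (A \<union> B)))
    = fps_nth (fps_shift 2 catalan_gf * (1 + catalan_gf) ^ m) (card B)"
  using assms
proof (induction m arbitrary: A B)
  case 0
  have "A \<inter> B = {}" using 0(3) by blast
  then have "card (A \<union> B) = card B + 2" using 0 by (simp add: card_Un_disjoint)
  moreover have "nc_rels A (A \<union> B) = nc_rels {} (A \<union> B)"
    using 0 by (intro nc_rels_card_le_2) (auto simp: Int_absorb2)
  ultimately show ?case using 0 by (simp add: card_nc_rels_empty)
next
  case (Suc m)
  let ?F = "fps_shift 2 catalan_gf * (1 + catalan_gf) ^ m"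
  define p where "p = Min A"
  define A' where "A' = A - {p}"
  have "A \<noteq> {}" using Suc.prems(4) by auto
  then have A: "A = insert p A'" and pA: "p \<in> A" "p \<notin> A'" and finA: "finite A'"
    using Suc.prems(1) Min_in[of A] by (auto simp: A'_def p_def simp del: Min_in)
  have pA': "p < y" if "y \<in> A'" for y
    using that Suc.prems(1) by (auto simp: A'_def p_def order_less_le)
  define Y where "Y = A' \<union> B"
  have p: "p < y" if "y \<in> Y" for y
    using that pA' Suc.prems(3) pA(1) by (auto simp: Y_def)
  have cA: "card A' = m + 2" using Suc.prems(4) A pA finA by simp
  have finY: "finite Y" using finA Suc.prems(2) by (simp add: Y_def)
  have AB: "a < b" if "a \<in> A'" "b \<in> B" for a b using that Suc.prems(3) by (auto simp: A)
  then have dis: "A' \<inter> B = {}" by blast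
  \<comment> \<open>The induction hypothesis speaks of \<open>A'\<close>, the cut pieces of
    \<open>A\<close>; both have the same trace on \<open>A' \<union> Z\<close>, as \<open>p\<close>
    is not in it.\<close>
  have IH: "real (card (nc_rels A (A' \<union> Z))) = fps_nth ?F (card Z)" if Z: "Z \<subseteq> B" for Z
  proof -
    have "A \<inter> (A' \<union> Z) = A' \<inter> (A' \<union> Z)" using p Z by (auto simp: A Y_def)
    then have "nc_rels A (A' \<union> Z) = nc_rels A' (A' \<union> Z)" by (metis nc_rels_Int)
    then show ?thesis
      using Suc.IH[OF finA _ _ cA, of Z] Z AB finite_subset[OF Z Suc.prems(2)] by auto
  qed
  let ?t = "\<lambda>q. if p \<in> A \<and> q \<in> A \<and> (\<exists>y\<in>Y. y < q) then 0
       else card (nc_rels A {y\<in>Y. y < q}) * card (nc_rels A {y\<in>Y. q \<le> y})"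
  have "card (nc_rels A (insert p Y)) = card (nc_rels A Y) + (\<Sum>q\<in>Y. ?t q)"
  proof (rule card_nc_rels_insert_least)
    show "y \<in> A" if "y \<in> Y" "z \<in> A" "y < z" for y z
      using that AB p[of y] by (auto simp: A Y_def dest: less_asym)
  qed (use finY p in auto)
  also have "(\<Sum>q\<in>Y. ?t q) = (\<Sum>q\<in>A'. ?t q) + (\<Sum>q\<in>B. ?t q)"
    unfolding Y_def by (rule sum.union_disjoint) (use finA Suc.prems dis in auto)
  \<comment> \<open>Among diameter points only the next one after \<open>p\<close> can be its
    successor. Nothing lies below it in \<open>Y\<close>, so the lower factor is 1 and the upper
    part is all of \<open>Y\<close>.\<close>
  also have "(\<Sum>q\<in>A'. ?t q) = card (nc_rels A Y)"
  proof -
    define q where "q = Min A'"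
    have "A' \<noteq> {}" using cA by auto
    then have q: "q \<in> A'" "\<And>y. y \<in> A' \<Longrightarrow> q \<le> y" using finA by (auto simp: q_def)
    have qY: "q \<le> y" if "y \<in> Y" for y using that q(2) AB[OF q(1)] by (auto simp: Y_def less_imp_le)
    have "(\<Sum>q\<in>A'. ?t q) = ?t q + (\<Sum>q\<in>A' - {q}. ?t q)"
      by (rule sum.remove) (use finA q in auto)
    moreover have "?t y = 0" if "y \<in> A' - {q}" for y
    proof -
      have "q < y" "q \<in> Y" using that q(1) q(2)[of y] by (auto simp: Y_def)
      then show ?thesis using that by (auto simp: A)
    qed
    then have "(\<Sum>q\<in>A' - {q}. ?t q) = 0" by simp
    moreover have *: "{y\<in>Y. y < q} = {}" "{y\<in>Y. q \<le> y} = Y" "\<not> (\<exists>y\<in>Y. y < q)"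
      using qY by (auto simp: leD)
    have "?t q = card (nc_rels A Y)" unfolding *(1,2) using *(3) by (auto simp: nc_rels_empty)
    ultimately show ?thesis by simp
  qed
  also have "insert p Y = A \<union> B" by (simp add: A Y_def)
  finally have "real (card (nc_rels A (A \<union> B))) =
     fps_nth ?F (card B) + (fps_nth ?F (card B) + (\<Sum>q\<in>B. real (?t q)))"
    using IH[of B] by (simp only: Y_def of_nat_add of_nat_sum order_refl simp_thms)
  \<comment> \<open>For an arc point \<open>q\<close> the lower part keeps all remaining diameter
    points, so the induction hypothesis applies; the upper part has arc points only and is counted
    by a Catalan number.\<close>
  also have "(\<Sum>q\<in>B. real (?t q)) =
     (\<Sum>q\<in>B. fps_nth ?F (card {y\<in>B. y < q}) * fps_nth catalan_gf (card B - card {y\<in>B. y < q}))"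
  proof (rule sum.cong[OF refl])
    fix q assume q: "q \<in> B"
    have "q \<notin> A" using Suc.prems(3) q by blast
    moreover have "{y\<in>Y. y < q} = A' \<union> {y\<in>B. y < q}" using AB q by (auto simp: Y_def)
    moreover have YB: "{y\<in>Y. q \<le> y} = {y\<in>B. q \<le> y}" using AB[OF _ q] by (auto simp: Y_def dest: leD)
    moreover have "A \<inter> {y\<in>B. q \<le> y} = {}" using Suc.prems(3) by blast
    then have "nc_rels A {y\<in>B. q \<le> y} = nc_rels {} {y\<in>B. q \<le> y}" by (metis nc_rels_Int Int_empty_left)
    ultimately show "real (?t q) = fps_nth ?F (card {y\<in>B. y < q}) * fps_nth catalan_gf (card B - card {y\<in>B. y < q})"
      using IH[of "{y\<in>B. y < q}"] Suc.prems(2) by (simp add: card_nc_rels_empty card_ge_eq_diff)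
  qed
  also have "\<dots> = (\<Sum>i<card B. fps_nth ?F i * fps_nth catalan_gf (card B - i))"
    by (rule sum_card_less) (fact Suc.prems(2))
  \<comment> \<open>One copy of the coefficient becomes the term \<open>i = card B\<close> of the
    convolution with \<open>catalan_gf\<close>; the other yields the 1 in
    \<open>1 + catalan_gf\<close>.\<close>
  also have "fps_nth ?F (card B) + \<dots> = fps_nth (?F * catalan_gf) (card B)"
    by (simp only: fps_mult_nth atMost_atLeast0[symmetric] lessThan_Suc_atMost[symmetric]
        sum.lessThan_Suc) (simp add: catalan_gf_0)
  also have "fps_nth ?F (card B) + \<dots> = fps_nth (fps_shift 2 catalan_gf * (1 + catalan_gf) ^ Suc m) (card B)"
    by (simp add: algebra_simps flip: fps_add_nth)
  finally show ?case .
qed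

subsection \<open>Convex hulls of points on the half disc\<close>

text \<open>Twice the signed area of the triangle \<open>x\<close>, \<open>y\<close>,
  \<open>z\<close>, positive when these run counterclockwise.\<close>

definition orient :: "complex \<Rightarrow> complex \<Rightarrow> complex \<Rightarrow> real" where
  "orient x y z = (Re y - Re x) * (Im z - Im x) - (Im y - Im x) * (Re z - Re x)"

lemma orient_rotate: "orient y z x = orient x y z"
  by (simp add: orient_def algebra_simps)

lemma orient_swap: "orient x z y = - orient x y z"
  by (simp add: orient_def algebra_simps)

text \<open>Increasing along the diameter from \<open>-1\<close> to \<open>1\<close> and then counterclockwise along the
  arc.\<close>

definition bdry_key :: "complex \<Rightarrow> real" where
  "bdry_key z = (if Im z = 0 then Re z else 2 - Re z)"

definition diameter_pts :: "complex set" where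
  "diameter_pts = {z. Im z = 0 \<and> \<bar>Re z\<bar> \<le> 1}"

definition arc_pts :: "complex set" where
  "arc_pts = {z. Im z > 0 \<and> Re z ^ 2 + Im z ^ 2 = 1}"

lemma closed_segment_diameter: "closed_segment (-1) 1 = diameter_pts"
proof -
  have "closed_segment (-1) (1::complex) = of_real ` closed_segment (-1) 1"
    using closed_segment_of_real[of "-1" 1] by simp
  also have "\<dots> = diameter_pts"
    by (auto simp: diameter_pts_def closed_segment_eq_real_ivl image_iff complex_eq_iff
        intro!: bexI[of _ "Re _"])
  finally show ?thesis .
qed

lemma exp_arc: "{exp (\<i> * of_real \<theta>) | \<theta>. 0 < \<theta> \<and> \<theta> < pi} \<subseteq> arc_pts"
  by (auto simp: arc_pts_def Re_exp Im_exp sin_gt_zero)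

lemma Re_arc: "z \<in> arc_pts \<Longrightarrow> \<bar>Re z\<bar> < 1"
proof -
  assume z: "z \<in> arc_pts"
  then have "0 < Im z ^ 2" by (auto simp: arc_pts_def)
  then have "Re z ^ 2 < 1" using z unfolding arc_pts_def mem_Collect_eq by linarith
  then show ?thesis by (simp add: abs_square_less_1)
qed

text \<open>Arc points have real part strictly below 1, so the offset 2 places their keys after all
  those of the diameter.\<close>

lemma arc_key: "z \<in> arc_pts \<Longrightarrow> bdry_key z = 2 - Re z \<and> 1 < bdry_key z"
  using Re_arc[of z] by (auto simp: bdry_key_def arc_pts_def)

lemma diameter_key: "z \<in> diameter_pts \<Longrightarrow> bdry_key z = Re z \<and> bdry_key z \<le> 1"
  by (auto simp: bdry_key_def diameter_pts_def)

text \<open>The value 1 separates the keys of diameter and arc. Within each part the real part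
  determines the point, on the arc because the imaginary part is the positive root.\<close>

lemma inj_on_bdry_key: "inj_on bdry_key (diameter_pts \<union> arc_pts)"
proof (rule inj_onI)
  fix x y assume xy: "x \<in> diameter_pts \<union> arc_pts" "y \<in> diameter_pts \<union> arc_pts" "bdry_key x = bdry_key y"
  then consider "x \<in> diameter_pts" "y \<in> diameter_pts" | "x \<in> arc_pts" "y \<in> arc_pts"
    using arc_key[of x] arc_key[of y] diameter_key[of x] diameter_key[of y] by auto
  then show "x = y"
  proof cases
    case 1
    then show ?thesis using xy(3) diameter_key[OF 1(1)] diameter_key[OF 1(2)]
      by (auto simp: diameter_pts_def complex_eq_iff)
  next
    case 2
    then have "Re x = Re y" using xy(3) arc_key[OF 2(1)] arc_key[OF 2(2)] by auto
    moreover from this have sq: "Im x ^ 2 = Im y ^ 2"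
      using 2 unfolding arc_pts_def mem_Collect_eq by (metis add_left_imp_eq)
    have "Im x = Im y" by (rule power2_eq_imp_eq[OF sq]) (use 2 in \<open>auto simp: arc_pts_def\<close>)
    ultimately show ?thesis by (simp add: complex_eq_iff)
  qed
qed

text \<open>The chord from \<open>x\<close> to \<open>z\<close> runs inside the disc, strictly below the arc point \<open>y\<close>.\<close>

lemma orient_circle_pos:
  assumes x: "Re x ^ 2 + Im x ^ 2 = 1" and y: "y \<in> arc_pts"
    and z: "Re z ^ 2 + Im z ^ 2 = 1" and lt: "Re z < Re y" "Re y < Re x"
  shows "0 < orient x y z"
proof -
  \<comment> \<open>These are the weights of \<open>x\<close> and \<open>z\<close> at which the
    chord has the real part of \<open>y\<close>.\<close>
  define s t where "s = Re y - Re z" and "t = Re x - Re y"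
  have st: "s > 0" "t > 0" using lt by (simp_all add: s_def t_def)
  have e: "Re y * (s + t) = Re x * s + Re z * t" by (simp add: s_def t_def algebra_simps)
  have "0 < (Re x - Re z) ^ 2 + (Im x - Im z) ^ 2" using lt
    by (intro add_pos_nonneg) auto
  \<comment> \<open>Distinct unit vectors have inner product below 1, so the weighted mean of
    \<open>x\<close> and \<open>z\<close> lies strictly inside the disc.\<close>
  then have "Re x * Re z + Im x * Im z < 1"
    using x z by (simp add: power2_eq_square algebra_simps)
  then have "2 * s * t * (Re x * Re z + Im x * Im z) < 2 * s * t * 1"
    using st by (intro mult_strict_left_mono) auto
  moreover have "(Im x * s + Im z * t) ^ 2 + (Re x * s + Re z * t) ^ 2
      = (Re x ^ 2 + Im x ^ 2) * s ^ 2 + (Re z ^ 2 + Im z ^ 2) * t ^ 2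
        + 2 * s * t * (Re x * Re z + Im x * Im z)"
    by (simp add: power2_eq_square algebra_simps)
  ultimately have "(Im x * s + Im z * t) ^ 2 + (Re y * (s + t)) ^ 2 < (s + t) ^ 2"
    unfolding e x z by (simp add: power2_eq_square algebra_simps)
  also have "(s + t) ^ 2 = (Re y ^ 2 + Im y ^ 2) * (s + t) ^ 2" using y by (simp add: arc_pts_def)
  finally have "(Im x * s + Im z * t) ^ 2 < (Im y * (s + t)) ^ 2"
    by (simp add: power_mult_distrib distrib_right)
  then have "Im x * s + Im z * t < Im y * (s + t)"
    by (rule power2_less_imp_less) (use y st in \<open>auto simp: arc_pts_def\<close>)
  then show ?thesis by (simp add: orient_def s_def t_def algebra_simps)
qed

text \<open>If \<open>y\<close> is on the diameter, so is \<open>x\<close>, and the sign is that of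
  the height of \<open>z\<close>. If \<open>x\<close> and \<open>y\<close> are on the arc, the
  circle lemma applies. If only \<open>y\<close> is, \<open>orient\<close> is affine in
  \<open>x\<close> and positive at both ends of the diameter.\<close>

lemma orient_pos:
  assumes x: "x \<in> diameter_pts \<union> arc_pts" and y: "y \<in> diameter_pts \<union> arc_pts" and z: "z \<in> arc_pts"
    and lt: "bdry_key x < bdry_key y" "bdry_key y < bdry_key z"
  shows "0 < orient x y z"
proof (cases "y \<in> arc_pts")
  case False
  then have y: "y \<in> diameter_pts" using y by blast
  then have "x \<notin> arc_pts" using diameter_key[of y] arc_key[of x] lt by force
  then have x: "x \<in> diameter_pts" using x by blast
  show ?thesis using x y z lt diameter_key[OF x] diameter_key[OF y]
    by (simp add: orient_def diameter_pts_def arc_pts_def)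
next
  case y: True
  have yz: "Re z < Re y" using arc_key[OF y] arc_key[OF z] lt by simp
  show ?thesis
  proof (cases "x \<in> arc_pts")
    case True
    then show ?thesis using arc_key[OF y] arc_key[of x] lt y z yz
      by (intro orient_circle_pos) (auto simp: arc_pts_def)
  next
    case False
    then have x: "x \<in> diameter_pts" using x by blast
    have 1: "0 < orient 1 y z" using Re_arc[OF y] z yz y
      by (intro orient_circle_pos) (auto simp: arc_pts_def)
    have "0 < orient y z (-1)" using Re_arc[OF z] z yz y
      by (intro orient_circle_pos) (auto simp: arc_pts_def)
    then have 2: "0 < orient (-1) y z" unfolding orient_rotate[of y z "-1"] .
    have "2 * orient x y z = (1 + Re x) * orient 1 y z + (1 - Re x) * orient (-1) y z"
      using x by (simp add: orient_def diameter_pts_def algebra_simps)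
    moreover have "0 < (1 + Re x) * orient 1 y z + (1 - Re x) * orient (-1) y z"
    proof (cases "Re x = 1")
      case False
      then show ?thesis using x 1 2
        by (intro add_nonneg_pos mult_nonneg_nonneg mult_pos_pos) (auto simp: diameter_pts_def)
    qed (use 1 in simp)
    ultimately show ?thesis by simp
  qed
qed

lemma diameter_key_le:
  assumes "x \<in> diameter_pts \<union> arc_pts" "y \<in> diameter_pts" "bdry_key x \<le> bdry_key y"
  shows "x \<in> diameter_pts"
proof (rule ccontr)
  assume "x \<notin> diameter_pts"
  then have "1 < bdry_key x" using assms(1) arc_key[of x] by blast
  then show False using assms(3) diameter_key[OF assms(2)] by simp
qed

text \<open>Once \<open>z\<close> is on the diameter the order forces all three points onto it, and
  the value is zero.\<close>

lemma orient_nonneg: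
  assumes x: "x \<in> diameter_pts \<union> arc_pts" and y: "y \<in> diameter_pts \<union> arc_pts" and z: "z \<in> diameter_pts \<union> arc_pts"
    and lt: "bdry_key x < bdry_key y" "bdry_key y < bdry_key z"
  shows "0 \<le> orient x y z"
proof (cases "z \<in> arc_pts")
  case True
  then show ?thesis using orient_pos[OF x y True lt] by simp
next
  case False
  then have z: "z \<in> diameter_pts" using z by blast
  then have "x \<in> diameter_pts" "y \<in> diameter_pts"
    using diameter_key_le x y lt by (meson less_imp_le less_trans)+
  with z show ?thesis by (simp add: orient_def diameter_pts_def)
qed

text \<open>Radon's affine dependency of four points; with nonnegative coefficients it exhibits the
  common point of the chords \<open>ac\<close> and \<open>bd\<close>.\<close>

lemma orient_radon:
  "of_real (orient b c d) * a + of_real (orient a b d) * c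
    = of_real (orient a c d) * b + of_real (orient a b c) * d"
  "orient b c d + orient a b d = orient a c d + orient a b c"
  by (simp_all add: orient_def complex_eq_iff algebra_simps)

lemma weighted_mem_segment:
  fixes a b :: complex
  assumes "0 \<le> s" "0 \<le> t" "0 < s + t"
  shows "(of_real s * a + of_real t * b) / of_real (s + t) \<in> closed_segment a b"
proof -
  have "(of_real s * a + of_real t * b) / of_real (s + t)
      = (s / (s + t)) *\<^sub>R a + (t / (s + t)) *\<^sub>R b"
    by (simp add: scaleR_conv_of_real add_divide_distrib)
  moreover have "s / (s + t) = 1 - t / (s + t)" "t / (s + t) \<le> 1" "0 \<le> t / (s + t)"
    using assms by (simp_all add: field_simps)
  ultimately show ?thesis by (auto simp: closed_segment_def)
qed

lemma diameter_between:
  assumes "a \<in> diameter_pts" "b \<in> diameter_pts" "c \<in> diameter_pts"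
    "bdry_key a < bdry_key b" "bdry_key b < bdry_key c"
  shows "b \<in> closed_segment a c"
proof -
  have lt: "Re a < Re b" "Re b < Re c" using assms diameter_key by metis+
  have "(of_real (Re c - Re b) * a + of_real (Re b - Re a) * c) / of_real ((Re c - Re b) + (Re b - Re a))
      \<in> closed_segment a c"
    by (rule weighted_mem_segment) (use lt in auto)
  also have "(of_real (Re c - Re b) * a + of_real (Re b - Re a) * c) / of_real ((Re c - Re b) + (Re b - Re a)) = b"
    using assms lt by (simp add: complex_eq_iff diameter_pts_def field_simps)
  finally show ?thesis .
qed

text \<open>With \<open>d\<close> on the arc the Radon coefficients are nonnegative with positive
  sums, so normalising both sides gives one point on both chords. Otherwise all four points are on
  the diameter and \<open>b\<close> itself is common.\<close>

lemma crossing_segments: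
  assumes "a \<in> diameter_pts \<union> arc_pts" "b \<in> diameter_pts \<union> arc_pts"
    "c \<in> diameter_pts \<union> arc_pts" "d \<in> diameter_pts \<union> arc_pts"
    and lt: "bdry_key a < bdry_key b" "bdry_key b < bdry_key c" "bdry_key c < bdry_key d"
  shows "closed_segment a c \<inter> closed_segment b d \<noteq> {}"
proof (cases "d \<in> arc_pts")
  case True
  let ?z = "(of_real (orient b c d) * a + of_real (orient a b d) * c) / of_real (orient b c d + orient a b d)"
  have "0 < orient b c d" "0 < orient a b d" "0 < orient a c d" "0 \<le> orient a b c"
    using assms True by (intro orient_pos orient_nonneg; simp)+
  then have "?z \<in> closed_segment a c" "(of_real (orient a c d) * b + of_real (orient a b c) * d) / of_real (orient a c d + orient a b c) \<in> closed_segment b d"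
    by (intro weighted_mem_segment; simp)+
  then show ?thesis unfolding orient_radon by blast
next
  case False
  then have "d \<in> diameter_pts" using assms by blast
  then have "a \<in> diameter_pts" "b \<in> diameter_pts" "c \<in> diameter_pts"
    using assms diameter_key_le[of a d] diameter_key_le[of b d] diameter_key_le[of c d] by simp_all
  then have "b \<in> closed_segment a c" using lt by (intro diameter_between)
  then show ?thesis by auto
qed

section \<open>Separation of convex hulls\<close>

lemma orient_inner:
  "orient x y z = inner (Complex (Im x - Im y) (Re y - Re x)) z - inner (Complex (Im x - Im y) (Re y - Re x)) x"
  by (simp add: orient_def inner_complex_def algebra_simps)

lemma convex_orient: "convex {z. 0 < orient x y z}" "convex {z. orient x y z \<le> 0}"
  unfolding orient_inner diff_gt_0_iff_gt diff_le_0_iff_le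
  using convex_halfspace_gt convex_halfspace_le by blast+

text \<open>An open half plane with an open ray of its boundary, able to separate sets that meet the
  same boundary line. A combination with positive weights stays on the axis only if both points are
  there.\<close>

lemma convex_upper_or_left: "convex {z. 0 < Im z \<or> Im z = 0 \<and> Re z < t}"
proof (rule convexI)
  fix x y :: complex and u v :: real
  assume x: "x \<in> {z. 0 < Im z \<or> Im z = 0 \<and> Re z < t}" and y: "y \<in> {z. 0 < Im z \<or> Im z = 0 \<and> Re z < t}"
    and uv: "0 \<le> u" "0 \<le> v" "u + v = 1"
  consider "u = 0" | "v = 0" | "0 < u" "0 < v" using uv by fastforce
  then show "u *\<^sub>R x + v *\<^sub>R y \<in> {z. 0 < Im z \<or> Im z = 0 \<and> Re z < t}"
  proof cases
    case 3
    show ?thesis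
    proof (cases "Im x = 0 \<and> Im y = 0")
      case True
      then have "u * Re x + v * Re y < u * t + v * t"
        using x y 3 by (intro add_strict_mono mult_strict_left_mono) auto
      also have "\<dots> = t" using uv by (simp flip: distrib_right)
      finally show ?thesis using True by simp
    next
      case False
      then have "0 < u * Im x + v * Im y"
        using x y 3 by (auto intro: add_pos_pos add_pos_nonneg add_nonneg_pos)
      then show ?thesis by simp
    qed
  qed (use x y uv in auto)
qed

text \<open>The first and last points \<open>v0\<close>, \<open>v1\<close> of \<open>V\<close> in
  the boundary order decide how to separate: by the upper half plane with a left ray if
  \<open>V\<close> is on the diameter, by the tangent at \<open>v1\<close> if \<open>V\<close> is a
  single arc point, and by the line through \<open>v0\<close> and \<open>v1\<close>
  otherwise.\<close>

lemma convex_hulls_disjnt: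
  assumes U: "U \<subseteq> diameter_pts \<union> arc_pts" and V: "V \<subseteq> diameter_pts \<union> arc_pts"
    and fin: "finite V" "V \<noteq> {}" and dis: "U \<inter> V = {}"
    and nc: "\<And>u v v'. u \<in> U \<Longrightarrow> v \<in> V \<Longrightarrow> v' \<in> V \<Longrightarrow> bdry_key v < bdry_key u \<Longrightarrow> bdry_key v' \<le> bdry_key u"
    and cv: "\<And>u v. u \<in> U \<Longrightarrow> u \<in> diameter_pts \<Longrightarrow> v \<in> V \<Longrightarrow> v \<in> diameter_pts \<Longrightarrow> bdry_key u \<le> bdry_key v"
  shows "disjnt (convex hull U) (convex hull V)"
proof -
  have separate: ?thesis if "U \<subseteq> H" "convex H" "V \<subseteq> K" "convex K" "H \<inter> K = {}" for H K
    using hull_minimal[of U H convex] hull_minimal[of V K convex] that by (auto simp: disjnt_def)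
  have "Min (bdry_key ` V) \<in> bdry_key ` V" "Max (bdry_key ` V) \<in> bdry_key ` V"
    using fin by auto
  then obtain v0 v1 where v: "v0 \<in> V" "v1 \<in> V"
    and "Min (bdry_key ` V) = bdry_key v0" "Max (bdry_key ` V) = bdry_key v1" by blast
  then have le: "bdry_key v0 \<le> bdry_key x" "bdry_key x \<le> bdry_key v1" if "x \<in> V" for x
    using that fin by (metis Min_le finite_imageI imageI, metis Max_ge finite_imageI imageI)
  have ne: "bdry_key u \<noteq> bdry_key x" if "u \<in> U" "x \<in> V" for u x
    using that inj_onD[OF inj_on_bdry_key, of u x] U V dis by blast
  consider "v1 \<in> diameter_pts" | "v1 \<in> arc_pts" "V = {v1}" | "v1 \<in> arc_pts" "bdry_key v0 < bdry_key v1"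
  proof -
    have "x = v1" if "bdry_key v0 = bdry_key v1" "x \<in> V" for x
      using that le[of x] inj_onD[OF inj_on_bdry_key, of x v1] v V by auto
    then have "V = {v1}" if "bdry_key v0 = bdry_key v1" using that v by blast
    then show ?thesis using that v V le(2)[OF v(1)] by (meson UnE in_mono order_le_less)
  qed
  then show ?thesis
  proof cases
    case 1
    have Vd: "x \<in> diameter_pts" if "x \<in> V" for x
      using diameter_key_le[OF _ 1 le(2)[OF that]] V that by blast
    show ?thesis
    proof (rule separate)
      show "U \<subseteq> {z. 0 < Im z \<or> Im z = 0 \<and> Re z < Re v0}"
      proof
        fix u assume u: "u \<in> U"
        show "u \<in> {z. 0 < Im z \<or> Im z = 0 \<and> Re z < Re v0}"
        proof (cases "u \<in> diameter_pts")
          case True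
          then have "bdry_key u < bdry_key v0" using cv[OF u True v(1) Vd] ne[OF u v(1)] v by simp
          then show ?thesis
            using True Vd[OF v(1)] diameter_key[of u] diameter_key[of v0] by (auto simp: diameter_pts_def)
        qed (use u U in \<open>auto simp: arc_pts_def\<close>)
      qed
      show "V \<subseteq> {z. Im z = 0} \<inter> {z. Re z \<ge> Re v0}"
      proof
        fix x assume x: "x \<in> V"
        show "x \<in> {z. Im z = 0} \<inter> {z. Re z \<ge> Re v0}"
          using Vd[OF x] Vd[OF v(1)] le(1)[OF x] diameter_key[of x] diameter_key[of v0]
          by (auto simp: diameter_pts_def)
      qed
      show "convex ({z. Im z = 0} \<inter> {z. Re z \<ge> Re v0})"
        by (intro convex_Int convex_halfspace_Re_ge) (auto simp: convex_def)
    qed (auto simp: convex_upper_or_left)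
  next
    case 2
    \<comment> \<open>The tangent at \<open>v1\<close> is \<open>inner v1 z = 1\<close>. The bound
      follows by expanding the squared distance of \<open>v1\<close> and \<open>u\<close>, which is
      positive, with \<open>v1\<close> of norm 1 and \<open>u\<close> of norm at most 1.\<close>
    have "inner v1 u < 1" if u: "u \<in> U" for u
    proof -
      have "inner u u \<le> 1"
      proof (cases "u \<in> arc_pts")
        case False
        then have "Im u = 0" "(Re u)\<^sup>2 \<le> 1"
          using u U by (auto simp: diameter_pts_def abs_square_le_1)
        then show ?thesis by (simp add: inner_complex_def power2_eq_square)
      qed (simp add: inner_complex_def arc_pts_def power2_eq_square)
      moreover have "inner v1 v1 = 1"
        using 2 by (auto simp: inner_complex_def arc_pts_def power2_eq_square)
      moreover have "0 < inner (v1 - u) (v1 - u)" using u v dis by auto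
      ultimately show ?thesis by (simp add: inner_diff inner_commute)
    qed
    moreover have "inner v1 v1 = 1"
      using 2 by (auto simp: inner_complex_def arc_pts_def power2_eq_square)
    ultimately show ?thesis
      using 2 by (intro separate[of "{z. inner v1 z < 1}" "{v1}"]) (auto simp: convex_halfspace_lt)
  next
    case 3
    show ?thesis
    proof (rule separate)
      show "U \<subseteq> {z. 0 < orient v0 v1 z}"
      proof
        fix u assume u: "u \<in> U"
        note ne = ne[OF u v(1)] ne[OF u v(2)]
        \<comment> \<open>By \<open>nc\<close> the point \<open>u\<close> comes before
          \<open>v0\<close> or after \<open>v1\<close>; either way \<open>v0\<close>,
          \<open>v1\<close>, \<open>u\<close> is in boundary order up to rotation.\<close>
        consider "bdry_key u < bdry_key v0" | "bdry_key v1 < bdry_key u"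
          using nc[OF u v(1,2)] ne by linarith
        then have "0 < orient v0 v1 u"
        proof cases
          case 1
          then show ?thesis
            using orient_pos[of u v0 v1] u v U V 3 unfolding orient_rotate[of v0 v1 u] by blast
        next
          case 2
          then have "u \<in> arc_pts" using arc_key[OF 3(1)] diameter_key[of u] u U by auto
          then show ?thesis using orient_pos[of v0 v1 u] 2 3 v V by blast
        qed
        then show "u \<in> {z. 0 < orient v0 v1 z}" by simp
      qed
      show "V \<subseteq> {z. orient v0 v1 z \<le> 0}"
      proof
        fix x assume x: "x \<in> V"
        consider "x = v0" | "x = v1" | "bdry_key v0 < bdry_key x" "bdry_key x < bdry_key v1"
          using le[OF x] inj_onD[OF inj_on_bdry_key, of x v0] inj_onD[OF inj_on_bdry_key, of x v1] x v V
          by (force simp: order_le_less)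
        then show "x \<in> {z. orient v0 v1 z \<le> 0}"
        proof cases
          case 3
          then have "0 \<le> orient v0 x v1" using x v V by (intro orient_nonneg) auto
          then show ?thesis using orient_swap[where x = v0 and y = x and z = v1] by simp
        qed (auto simp: orient_def)
      qed
    qed (auto simp: convex_orient)
  qed
qed

subsection \<open>Noncrossing partitions of a configuration\<close>

text \<open>Blocks are carried over to the real keys because \<open>nc_rels\<close> needs a linear
  order.\<close>

definition key_rel :: "complex set set \<Rightarrow> real rel" where
  "key_rel P = {(s, t). \<exists>U\<in>P. \<exists>x\<in>U. \<exists>y\<in>U. s = bdry_key x \<and> t = bdry_key y}"

text \<open>The inverse pulls a relation back along the injective \<open>bdry_key\<close> and takes
  the quotient. A forbidden pattern yields a common point of two hulls; conversely
  \<open>convex_hulls_disjnt\<close> separates distinct classes.\<close>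

lemma bij_betw_noncrossing_partitions:
  assumes A: "A \<subseteq> diameter_pts" and B: "B \<subseteq> arc_pts" and fin: "finite A" "finite B"
  shows "bij_betw key_rel
    (noncrossing_partitions (A \<union> B)) (nc_rels (bdry_key ` A) (bdry_key ` (A \<union> B)))"
    (is "bij_betw _ ?N ?R")
proof -
  define S where "S = A \<union> B"
  define E where "E r = {(x, y). x \<in> S \<and> y \<in> S \<and> (bdry_key x, bdry_key y) \<in> r}" for r
  have S: "S \<subseteq> diameter_pts \<union> arc_pts" and finS: "finite S" using A B fin by (auto simp: S_def)
  have key_eq: "x = y" if "x \<in> S" "y \<in> S" "bdry_key x = bdry_key y" for x y
    using that S inj_onD[OF inj_on_bdry_key, of x y] by blast
  have key_A: "x \<in> A" if "x \<in> S" "bdry_key x \<in> bdry_key ` A" for x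
    using that key_eq[of x] by (auto simp: S_def)
  have part: "partition_on S P" if "P \<in> ?N" for P
    using that by (simp add: noncrossing_partitions_def S_def)
  have PS: "U \<subseteq> S" if "P \<in> ?N" "U \<in> P" for P U
    using partition_onD1[OF part[OF that(1)]] that(2) by blast
  have block_eq: "U = V" if "P \<in> ?N" "U \<in> P" "V \<in> P" "z \<in> convex hull U" "z \<in> convex hull V" for P U V z
    using that by (auto simp: noncrossing_partitions_def pairwise_def disjnt_def)
  have block_eq': "U = V" if "P \<in> ?N" "U \<in> P" "V \<in> P" "z \<in> U" "z \<in> V" for P U V z
    using block_eq[OF that(1-3)] that(4,5) hull_subset[of U convex] hull_subset[of V convex] by blast
  have G_iff: "(bdry_key x, bdry_key y) \<in> key_rel P \<longleftrightarrow> (\<exists>U\<in>P. x \<in> U \<and> y \<in> U)"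
    if P: "P \<in> ?N" and "x \<in> S" "y \<in> S" for P x y
  proof
    assume "(bdry_key x, bdry_key y) \<in> key_rel P"
    then obtain x' y' U where *: "bdry_key x = bdry_key x'" "bdry_key y = bdry_key y'" "U \<in> P" "x' \<in> U" "y' \<in> U"
      by (auto simp: key_rel_def)
    then have "x' \<in> S" "y' \<in> S" using PS[OF P *(3)] by auto
    then have "x = x'" "y = y'" using * that by (auto intro: key_eq)
    then show "\<exists>U\<in>P. x \<in> U \<and> y \<in> U" using * by auto
  qed (auto simp: key_rel_def)
  have segment: "closed_segment x y \<subseteq> convex hull U" if "x \<in> U" "y \<in> U" for x y :: complex and U
    using that by (intro closed_segment_subset_convex_hull hull_inc)
  show ?thesis
  proof (rule bij_betw_byWitness[where f' = "\<lambda>r. S // E r"])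
    show "\<forall>P\<in>?N. S // E (key_rel P) = P"
    proof
      fix P assume P: "P \<in> ?N"
      have "E (key_rel P) = {(x, y). \<exists>U\<in>P. x \<in> U \<and> y \<in> U}"
      proof (intro set_eqI, clarify)
        fix x y
        show "(x, y) \<in> E (key_rel P) \<longleftrightarrow> (x, y) \<in> {(x, y). \<exists>U\<in>P. x \<in> U \<and> y \<in> U}"
          using G_iff[OF P, of x y] PS[OF P] by (auto simp: E_def)
      qed
      then show "S // E (key_rel P) = P" using partition_on_eq_quotient[OF part[OF P]] by simp
    qed
    show "key_rel ` ?N \<subseteq> ?R"
    proof
      fix r assume "r \<in> key_rel ` ?N"
      then obtain P where P: "P \<in> ?N" and r: "r = key_rel P" by blast
      have rS: "\<exists>x y U. s = bdry_key x \<and> t = bdry_key y \<and> x \<in> S \<and> y \<in> S \<and> U \<in> P \<and> x \<in> U \<and> y \<in> U"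
        if "(s, t) \<in> r" for s t
        using that PS[OF P] by (auto simp: r key_rel_def)
      show "r \<in> ?R"
        unfolding S_def[symmetric]
      proof (rule nc_relsI)
        show "r \<subseteq> bdry_key ` S \<times> bdry_key ` S" using rS by auto
        show "(s, s) \<in> r" if "s \<in> bdry_key ` S" for s
          using that partition_onD1[OF part[OF P]] by (auto simp: r key_rel_def)
        show "(t, s) \<in> r" if "(s, t) \<in> r" for s t
          using that by (auto simp: r key_rel_def)
        show "(s, w) \<in> r" if st: "(s, t) \<in> r" "(t, w) \<in> r" for s t w
        proof -
          obtain x y U where 1: "s = bdry_key x" "t = bdry_key y" "x \<in> S" "y \<in> S" "U \<in> P" "x \<in> U" "y \<in> U"
            using rS[OF st(1)] by blast
          obtain y' z V where 2: "t = bdry_key y'" "w = bdry_key z" "y' \<in> S" "z \<in> S" "V \<in> P" "y' \<in> V" "z \<in> V"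
            using rS[OF st(2)] by blast
          have "y' = y" using 1 2 key_eq by simp
          then have "U = V" using block_eq'[OF P] 1 2 by blast
          then show ?thesis using 1 2 by (auto simp: r key_rel_def)
        qed
        show "(s1, s2) \<in> r" if lt: "s1 < s2" "s2 < s3" "s3 < s4" and s: "(s1, s3) \<in> r" "(s2, s4) \<in> r"
          for s1 s2 s3 s4
        proof -
          obtain a c U where 1: "s1 = bdry_key a" "s3 = bdry_key c" "a \<in> S" "c \<in> S" "U \<in> P" "a \<in> U" "c \<in> U"
            using rS[OF s(1)] by blast
          obtain b d V where 2: "s2 = bdry_key b" "s4 = bdry_key d" "b \<in> S" "d \<in> S" "V \<in> P" "b \<in> V" "d \<in> V"
            using rS[OF s(2)] by blast
          \<comment> \<open>Each chord lies in the hull of its block, so a common point makes the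
            blocks equal.\<close>
          have "closed_segment a c \<inter> closed_segment b d \<noteq> {}"
            using 1 2 lt S by (intro crossing_segments) auto
          then have "U = V"
            using block_eq[OF P 1(5) 2(5)] segment[OF 1(6,7)] segment[OF 2(6,7)] by blast
          then show ?thesis using 1 2 by (auto simp: r key_rel_def)
        qed
        show "(s1, s2) \<in> r" if sA: "s1 \<in> bdry_key ` A" "s2 \<in> bdry_key ` A" "s3 \<in> bdry_key ` A"
          and lt: "s1 < s2" "s2 < s3" and s: "(s1, s3) \<in> r" for s1 s2 s3
        proof -
          obtain a c U where 1: "s1 = bdry_key a" "s3 = bdry_key c" "a \<in> S" "c \<in> S" "U \<in> P" "a \<in> U" "c \<in> U"
            using rS[OF s] by blast
          obtain b where b: "s2 = bdry_key b" "b \<in> A" using sA by blast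
          then obtain V where V: "V \<in> P" "b \<in> V"
            using partition_onD1[OF part[OF P]] by (auto simp: S_def)
          have "a \<in> A" "c \<in> A" using 1 sA key_A by auto
          then have "b \<in> closed_segment a c"
            using A b lt 1 by (intro diameter_between) auto
          then have "U = V"
            using block_eq[OF P 1(5) V(1)] segment[OF 1(6,7)] hull_subset[of V convex] V(2) by blast
          then show ?thesis using 1 b V by (auto simp: r key_rel_def)
        qed
      qed
    qed
    have eqv: "equiv S (E r)" if r: "r \<in> ?R" for r
    proof (rule equivI)
      note * = nc_relsD[OF r, folded S_def]
      show "E r \<subseteq> S \<times> S" by (auto simp: E_def)
      show "refl_on S (E r)" using *(2) by (auto simp: E_def refl_on_def)
      show "sym (E r)" using *(3) by (auto simp: E_def sym_def)
      show "trans (E r)"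
      proof (rule transI)
        fix x y z assume "(x, y) \<in> E r" "(y, z) \<in> E r"
        then show "(x, z) \<in> E r" using *(4)[of "bdry_key x" "bdry_key y" "bdry_key z"] by (simp add: E_def)
      qed
    qed
    have class_iff: "x \<in> U \<longleftrightarrow> x \<in> S \<and> (bdry_key y, bdry_key x) \<in> r"
      if r: "r \<in> ?R" and "U \<in> S // E r" "y \<in> U" for r U x y
    proof -
      obtain z where z: "U = E r `` {z}" using \<open>U \<in> S // E r\<close> by (rule quotientE)
      then have "(z, y) \<in> E r" using \<open>y \<in> U\<close> by blast
      then have "U = E r `` {y}" "y \<in> S"
        using z equiv_class_eq[OF eqv[OF r]] by (auto simp: E_def)
      then show ?thesis by (auto simp: E_def)
    qed
    show "(\<lambda>r. S // E r) ` ?R \<subseteq> ?N"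
    proof
      fix P assume "P \<in> (\<lambda>r. S // E r) ` ?R"
      then obtain r where r: "r \<in> ?R" and P: "P = S // E r" by blast
      note * = nc_relsD[OF r, folded S_def]
      have partP: "partition_on S P" unfolding P by (rule partition_on_quotient[OF eqv[OF r]])
      have US: "U \<subseteq> S" if "U \<in> P" for U using partition_onD1[OF partP] that by blast
      have rel: "(bdry_key x, bdry_key y) \<in> r" if "U \<in> P" "x \<in> U" "y \<in> U" for U x y
        using class_iff[OF r, of U x y] that unfolding P by simp
      have nrel: "(bdry_key x, bdry_key y) \<notin> r" if "U \<in> P" "V \<in> P" "U \<inter> V = {}" "x \<in> U" "y \<in> V" for U V x y
        using class_iff[OF r, of U x y] class_iff[OF r, of U y x] that US[of V] unfolding P by auto
      \<comment> \<open>Letting \<open>U\<close> contain the least point \<open>m\<close> turns a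
        failure of either order hypothesis of \<open>convex_hulls_disjnt\<close> into a forbidden
        pattern: \<open>m\<close>, \<open>v\<close>, \<open>u\<close>, \<open>v'\<close> crossing,
        or \<open>m\<close>, \<open>v\<close>, \<open>u\<close> on the diameter.\<close>
      have sep: "disjnt (convex hull U) (convex hull V)"
        if U: "U \<in> P" and V: "V \<in> P" and dis: "U \<inter> V = {}"
          and m: "m \<in> U" "\<And>v. v \<in> V \<Longrightarrow> bdry_key m \<le> bdry_key v" for U V m
      proof (rule convex_hulls_disjnt)
        have lt: "bdry_key m < bdry_key v" if "v \<in> V" for v
          using m that key_eq[of m v] US[OF U] US[OF V] dis by (auto simp: order_le_less)
        show "finite V" using US[OF V] finS finite_subset by blast
        show "V \<noteq> {}" using V partP by (auto simp: partition_on_def)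
        show "bdry_key v' \<le> bdry_key u"
          if "u \<in> U" "v \<in> V" "v' \<in> V" "bdry_key v < bdry_key u" for u v v'
        proof (rule ccontr)
          assume "\<not> ?thesis"
          then have "(bdry_key m, bdry_key v) \<in> r"
            using *(5)[of "bdry_key m" "bdry_key v" "bdry_key u" "bdry_key v'"] lt[OF that(2)] that
              rel[OF U m(1)] rel[OF V that(2,3)] by simp
          then show False using nrel[OF U V dis m(1) that(2)] by simp
        qed
        show "bdry_key u \<le> bdry_key v"
          if "u \<in> U" "u \<in> diameter_pts" "v \<in> V" "v \<in> diameter_pts" for u v
        proof (rule ccontr)
          assume less: "\<not> ?thesis"
          have dA: "x \<in> A" if "x \<in> S" "x \<in> diameter_pts" for x
            using that B by (auto simp: S_def diameter_pts_def arc_pts_def)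
          have "m \<in> diameter_pts"
            using diameter_key_le[of m u] lt[OF that(3)] less that m(1) US[OF U] S by auto
          then have "bdry_key m \<in> bdry_key ` A" "bdry_key v \<in> bdry_key ` A" "bdry_key u \<in> bdry_key ` A"
            using dA that m(1) US[OF U] US[OF V] by blast+
          then have "(bdry_key m, bdry_key v) \<in> r"
            using *(6)[of "bdry_key m" "bdry_key v" "bdry_key u"] lt[OF that(3)] less that
              rel[OF U m(1)] US[OF V] by auto
          then show False using nrel[OF U V dis m(1) that(3)] by simp
        qed
      qed (use US[OF U] US[OF V] S dis in auto)
      have "disjnt (convex hull U) (convex hull V)" if U: "U \<in> P" and V: "V \<in> P" and "U \<noteq> V" for U V
      proof -
        have dis: "U \<inter> V = {}"
          using partP that by (auto simp: partition_on_def pairwise_def disjnt_def)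
        have "finite (bdry_key ` (U \<union> V))" "bdry_key ` (U \<union> V) \<noteq> {}"
          using US[OF U] US[OF V] finS U partP
          by (auto simp: partition_on_def intro!: finite_imageI intro: finite_subset)
        then obtain m where m: "m \<in> U \<union> V" "Min (bdry_key ` (U \<union> V)) = bdry_key m"
          using Min_in by (metis imageE)
        then have le: "bdry_key m \<le> bdry_key v" if "v \<in> U \<union> V" for v
          using that \<open>finite (bdry_key ` (U \<union> V))\<close> by (metis Min_le imageI)
        \<comment> \<open>Disjointness is symmetric, so whichever block contains \<open>m\<close>
          may play the role of \<open>U\<close> in \<open>sep\<close>.\<close>
        show ?thesis
        proof (cases "m \<in> U")
          case True
          then show ?thesis using sep[OF U V dis True] le by blast
        next
          case False
          then have "m \<in> V" using m by blast
          then have "disjnt (convex hull V) (convex hull U)" using sep[OF V U, of m] dis le by blast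
          then show ?thesis by (rule disjnt_sym)
        qed
      qed
      then show "P \<in> ?N"
        using partP by (auto simp: noncrossing_partitions_def pairwise_def S_def)
    qed
    show "\<forall>r\<in>?R. key_rel (S // E r) = r"
    proof
      fix r assume r: "r \<in> ?R"
      note * = nc_relsD[OF r, folded S_def]
      have "partition_on S (S // E r)" by (rule partition_on_quotient[OF eqv[OF r]])
      then have un: "\<Union> (S // E r) = S" by (metis partition_onD1)
      show "key_rel (S // E r) = r"
      proof (intro equalityI subsetI)
        fix p assume "p \<in> key_rel (S // E r)"
        then obtain x y U where p: "p = (bdry_key x, bdry_key y)" "U \<in> S // E r" "x \<in> U" "y \<in> U"
          by (auto simp: key_rel_def)
        then show "p \<in> r" using class_iff[OF r p(2,3), of y] by simp
      next
        fix p assume p: "p \<in> r"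
        then obtain x y where xy: "p = (bdry_key x, bdry_key y)" "x \<in> S" "y \<in> S" using *(1) by blast
        then obtain U where U: "U \<in> S // E r" "x \<in> U" using un by blast
        then have "y \<in> U" using class_iff[OF r U, of y] xy p by simp
        then show "p \<in> key_rel (S // E r)" using xy U by (auto simp: key_rel_def)
      qed
    qed
  qed
qed

section \<open>From partitions to the generating function\<close>

lemma card_noncrossing_partitions:
  assumes "is_configuration m n S"
  shows "real (card (noncrossing_partitions S))
    = fps_nth (fps_shift 2 catalan_gf * (1 + catalan_gf) ^ m) n"
proof -
  obtain A B where S: "S = A \<union> B" and A: "finite A" "card A = m + 2" "A \<subseteq> diameter_pts"
    and B: "finite B" "card B = n" "B \<subseteq> arc_pts"
  proof -
    obtain A B where "S = A \<union> B" "finite A" "card A = m + 2" "A \<subseteq> diameter_pts"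
      "finite B" "card B = n" and B: "B \<subseteq> {exp (\<i> * of_real \<theta>) | \<theta>. 0 < \<theta> \<and> \<theta> < pi}"
      using assms unfolding is_configuration_def closed_segment_diameter by blast
    moreover have "B \<subseteq> arc_pts" using B exp_arc by (rule subset_trans)
    ultimately show thesis using that by blast
  qed
  have inj: "inj_on bdry_key A" "inj_on bdry_key B"
    using A B by (auto intro: inj_on_subset[OF inj_on_bdry_key])
  have "card (noncrossing_partitions S) = card (nc_rels (bdry_key ` A) (bdry_key ` A \<union> bdry_key ` B))"
    using bij_betw_same_card[OF bij_betw_noncrossing_partitions[OF A(3) B(3) A(1) B(1)]]
    by (simp add: S image_Un)
  also have "real \<dots> = fps_nth (fps_shift 2 catalan_gf * (1 + catalan_gf) ^ m) (card (bdry_key ` B))"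
  proof (rule card_nc_rels)
    fix a b assume "a \<in> bdry_key ` A" "b \<in> bdry_key ` B"
    then obtain x y where "a = bdry_key x" "b = bdry_key y" "x \<in> diameter_pts" "y \<in> arc_pts"
      using A(3) B(3) by blast
    then show "a < b" using diameter_key[of x] arc_key[of y] by simp
  qed (use A B inj in \<open>simp_all add: card_image\<close>)
  finally show ?thesis using B inj by (simp add: card_image)
qed

text \<open>Stated over a ring because in the application the coefficients are themselves power
  series in \<open>y\<close>. Inverting a series inverts its constant term, here 1, by the
  \<open>inverse\<close> of that ring; hence the assumption.\<close>

lemma fps_geometric:
  fixes c :: "'a::{comm_ring_1, inverse}"
  assumes "inverse (1::'a) = 1"
  shows "1 / (1 - fps_X * fps_const c) = Abs_fps (\<lambda>m. c ^ m)"
proof -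
  let ?f = "1 - fps_X * fps_const c" and ?g = "Abs_fps (\<lambda>m. c ^ m)"
  have f0: "fps_nth ?f 0 = 1" by simp
  have "?f * ?g = 1"
  proof (rule fps_ext)
    fix n show "fps_nth (?f * ?g) n = fps_nth 1 n"
      by (cases n) (simp_all add: left_diff_distrib mult.assoc)
  qed
  then have "fps_right_inverse ?f (fps_nth ?g 0) = ?g"
    by (rule fps_lr_inverse_unique_ring1) simp
  then have "inverse ?f = ?g" using f0 assms by (simp add: fps_inverse_def)
  moreover have "subdegree ?f = 0" using f0 by (simp add: subdegree_eq_0_iff)
  ultimately show ?thesis by (simp add: fps_divide_unit')
qed

theorem theorem4p3:
  fixes S :: "nat \<Rightarrow> nat \<Rightarrow> complex set"
  assumes "\<And>m n. is_configuration m n (S m n)"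
  shows "Abs_fps (\<lambda>m. Abs_fps (\<lambda>n. real (card (noncrossing_partitions (S m n))))) =
    fps_const ((catalan_gf - 1 - fps_X) / fps_X ^ 2)
      * (1 / (1 - fps_X * fps_const (1 + catalan_gf)))"
proof -
  \<comment> \<open>\<open>C(y)\<close> begins with \<open>1 + y\<close>, so the numerator is
    divisible by \<open>y^2\<close> and the division is exact.\<close>
  have "catalan_gf - 1 - fps_X = fps_shift 2 catalan_gf * fps_X ^ 2"
  proof (rule fps_ext)
    fix n
    have "fps_nth catalan_gf 1 = 1" using catalan_gf_Suc[of 0] by (simp add: catalan_gf_0)
    moreover have "Suc (Suc (n - 2)) = n" if "0 < n" "n \<noteq> Suc 0" using that by simp
    ultimately show "fps_nth (catalan_gf - 1 - fps_X) n = fps_nth (fps_shift 2 catalan_gf * fps_X ^ 2) n"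
      by (auto simp: fps_X_power_mult_right_nth catalan_gf_0 less_2_cases_iff)
  qed
  then have D: "(catalan_gf - 1 - fps_X) / fps_X ^ 2 = fps_shift 2 catalan_gf"
    by simp
  have geom: "1 / (1 - fps_X * fps_const (1 + catalan_gf)) = Abs_fps (\<lambda>m. (1 + catalan_gf) ^ m)"
    by (rule fps_geometric) simp
  show ?thesis
    unfolding D geom card_noncrossing_partitions[OF assms]
    by (simp add: fps_eq_iff)
qed

end
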